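(* Let $\Psi(X,Y)=\sum_{r,s\ge0}c_{r,s}X^rY^s\in\mathbb Q[[X,Y]]$ with $$c_{r,s}=\frac{(\frac12)_{r+s}(1)_{r+s}(\frac32)_{r+s}}{(1)_r(\frac32)_r(2)_r(\frac12)_s(1)_s(\frac32)_s},$$ and put $W=1-\frac X2\Psi$, $\Lambda_0=16\,Y\,W^2$. With $I,J,\delta,\mathcal D$, $C(U)$ and $Q_4(t)$ as defined in the context, let $$\mathcal R(\Lambda)=\operatorname{Res}_U\!\left(C(U),\ \Lambda^2-2(I-U)\Lambda+I^2+2IU-3U^2+32J\right).$$ Then $\mathcal R(\Lambda_0)=0$, and the six roots of $\mathcal R$ are the squared differences $(t_i-t_j)^2$, $1\le i<j\le4$, of the roots $t_1,\dots,t_4$ of $Q_4$. Moreover $$\begin{aligned}\mathcal R(\Lambda)={}&\Lambda^6-4I\Lambda^5+2(3I^2+8J)\Lambda^4-4(I^3+4IJ-104\mathcal D)\Lambda^3\\&+(I^4-16I^2J-448J^2-384I\mathcal D)\Lambda^2\\&+16(I^3J+24IJ^2+18I^2\mathcal D+432J\mathcal D)\Lambda+\operatorname{Disc}_UC,\end{aligned}$$ and on a common edge, that is, for $Z=t_i+t_j$ and $\Lambda=(t_i-t_j)^2$ with $i<j$, one has $$\Lambda=I-Z^2-\frac{8\delta}{Z}.$$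
   Context: $(a)_n$ is the Pochhammer symbol. Let $\sigma_1=X+Y-1$, $\sigma_2=XY-X-Y$, $\sigma_3=-XY$, and $$I=\sigma_1^2-12\sigma_2,\quad J=\sigma_1^2\sigma_2-6\sigma_2^2+9\sigma_1\sigma_3,\quad \delta=(1+X)(1+Y)(X-Y),\quad \mathcal D=\delta^2,$$ $$C(U)=U^3-IU^2-8JU-16\mathcal D,\qquad Q_4(t)=t^4-\tfrac I2t^2+4\delta t+\left(\tfrac{I^2}{16}+2J\right).$$ The roots $t_1,\dots,t_4$ of $Q_4$ are taken in an algebraic closure of $\mathbb Q(X,Y)$, counted with multiplicity; $\operatorname{Disc}_U$ and $\operatorname{Res}_U$ denote the discriminant and resultant with respect to $U$. The identity $\mathcal R(\Lambda_0)=0$ is in $\mathbb Q[[X,Y]]$. *)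

theory Defs
  imports
    "HOL-Computational_Algebra.Computational_Algebra"
    "HOL-Algebra.Algebraic_Closure_Type"
    "Subresultants.Resultant_Prelim"
begin

(* Q[X,Y] is Q[X][Y]: the inner variable is X and the outer variable is Y.
   Q[[X,Y]] is Q[[X]][[Y]] with the same convention. *)
type_synonym qxy = "rat poly poly"
type_synonym qxy_series = "rat fps fps"
type_synonym qxy_closure = "qxy fract alg_closure"

definition qxy_to_series :: "qxy \<Rightarrow> qxy_series" where
  "qxy_to_series p = fps_of_poly (map_poly fps_of_poly p)"

definition qxy_to_closure :: "qxy \<Rightarrow> qxy_closure" where
  "qxy_to_closure p = to_ac (to_fract p)"

(* For n = degree p and leading coefficient a:
   Disc p = (-1)^(n(n-1)/2) Res(p, p') / a, where the division is exact. *)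
definition discriminant :: "'a :: {idom_divide, ring_char_0} poly \<Rightarrow> 'a" where
  "discriminant p =
     ((-1) ^ (degree p * (degree p - 1) div 2) * resultant p (pderiv p)) div lead_coeff p"

definition varX :: qxy where "varX = [:[:0, 1:]:]"
definition varY :: qxy where "varY = [:0, 1:]"

definition sigma1 :: qxy where "sigma1 = varX + varY - 1"
definition sigma2 :: qxy where "sigma2 = varX * varY - varX - varY"
definition sigma3 :: qxy where "sigma3 = - (varX * varY)"

definition invI :: qxy where "invI = sigma1 ^ 2 - 12 * sigma2"
definition invJ :: qxy where
  "invJ = sigma1 ^ 2 * sigma2 - 6 * sigma2 ^ 2 + 9 * sigma1 * sigma3"
definition delta :: qxy where "delta = (1 + varX) * (1 + varY) * (varX - varY)"
definition calD :: qxy where "calD = delta ^ 2"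

definition cubicC :: "qxy poly" where
  "cubicC =
     (let U = [:0, 1:]
      in U ^ 3 - [:invI:] * U ^ 2 - [:8 * invJ:] * U - [:16 * calD:])"

definition quarticQ :: "qxy poly" where
  "quarticQ =
     (let t = [:0, 1:]; q = (\<lambda>c :: rat. [:[:c:]:] :: qxy)
      in t ^ 4 - [:q (1/2) * invI:] * t ^ 2 + [:4 * delta:] * t
           + [:q (1/16) * invI ^ 2 + 2 * invJ:])"

(* The resultant is taken over Q[X,Y][Lambda]; calR is a polynomial in Lambda. *)
definition calR :: "qxy poly" where
  "calR =
     (let U = [:0, 1:] :: qxy poly poly;
          L = [:[:0, 1:]:] :: qxy poly poly;
          I = [:[:invI:]:]; J = [:[:invJ:]:]
      in resultant (map_poly (\<lambda>c. [:c:]) cubicC)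
           (L ^ 2 - 2 * (I - U) * L + I ^ 2 + 2 * I * U - 3 * U ^ 2 + 32 * J))"

definition psi_coeff :: "nat \<Rightarrow> nat \<Rightarrow> rat" where
  "psi_coeff r s =
     (pochhammer (1/2) (r + s) * pochhammer 1 (r + s) * pochhammer (3/2) (r + s)) /
     (pochhammer 1 r * pochhammer (3/2) r * pochhammer 2 r *
      pochhammer (1/2) s * pochhammer 1 s * pochhammer (3/2) s)"

definition Psi :: qxy_series where
  "Psi = Abs_fps (\<lambda>s. Abs_fps (\<lambda>r. psi_coeff r s))"

definition serW :: qxy_series where
  "serW = 1 - qxy_to_series ([:[:1/2:]:] * varX) * Psi"

definition Lambda0 :: qxy_series where
  "Lambda0 = 16 * qxy_to_series varY * serW ^ 2"

end

(* A root t of Q_4 is parametrized rationally on the surface X/a^2 + Y/b^2 = 1, a + b = 1: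
     2 t = 1 - 4 b + b^2 - X (2 - 2/a - 1/a^2).
   Solving Y = b^2 (1 - X/a^2) for b near b = 0 gives two branches b = beta(y) and b = beta(-y) in
   y = sqrt Y, hence two roots t_1, t_2 of Q_4.  Their difference is the odd part of the series 2 t(beta(y)),
   whose coefficients Lagrange inversion evaluates in closed form: t_1 - t_2 = -4 y W.  Hence
   Lambda_0 = 16 Y W^2 = (t_1 - t_2)^2.

   If t_1 and t_2 are distinct roots of Q_4, then U = (t_1 + t_2)^2 is a common root of C and of the quadratic
   at Lambda = (t_1 - t_2)^2, so R(Lambda_0) = 0.  As C has the roots (t_1 + t_j)^2 with 2 <= j <= 4, the
   resultant factors over the six squared differences. *)

theory Submission
  imports Defs
begin

section \<open>The resultant of a monic cubic and a quadratic\<close>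

text \<open>The identity for Lambda_0 lives in a power series ring, the statements on roots in an
  algebraic closure of Q(X,Y). What the two sides share is \<open>res_sextic\<close>, an explicit
  polynomial in I, J, D and Lambda that is compatible with every ring homomorphism. On the series
  side a single common root U suffices to make it vanish.

  The series computation takes place in Q((X))[[y]]. With a = 1 - b, the relation Y = b^2 (1 -
  X/a^2) has the square root y = b (1 - X/a^2)^(1/2). This series in b has no constant term and its
  linear coefficient (1 - X)^(1/2) is invertible, so beta is its compositional inverse. Lagrange
  inversion then asks for the coefficient of b^(2s) in (2t)' (1 - X/a^2)^(-(2s+1)/2). Expansion in X
  leaves powers of 1/(1 - b) with Pochhammer coefficients, which is where the Pochhammer products in
  c_{r,s} come from.\<close>

lemma det_Suc_mat:
  fixes f :: "nat \<times> nat \<Rightarrow> 'a :: comm_ring_1"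
  shows "det (mat (Suc n) (Suc n) f) =
    (\<Sum>i<Suc n. f (i, 0) * ((-1) ^ i * det (mat n n (\<lambda>(k, l). f (if k < i then k else Suc k, Suc l)))))"
proof -
  have "mat_delete (mat (Suc n) (Suc n) f) i 0 =
      mat n n (\<lambda>(k, l). f (if k < i then k else Suc k, Suc l))" if "i < Suc n" for i
    using that by (auto simp: mat_delete_def)
  then show ?thesis
    by (subst laplace_expansion_column[of _ "Suc n" 0])
       (auto simp: cofactor_def intro!: sum.cong)
qed

lemma det_mat_2:
  "det (mat (Suc (Suc 0)) (Suc (Suc 0)) f) = f (0,0) * f (1,1) - f (1,0) * (f (0,1) :: 'a :: comm_ring_1)"
  by (simp add: det_Suc_mat)

lemma det_mat_3:
  "det (mat (Suc (Suc (Suc 0))) (Suc (Suc (Suc 0))) f) =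
     f (0,0) * (f (1,1) * f (2,2) - f (2,1) * f (1,2))
     - f (1,0) * (f (0,1) * f (2,2) - f (2,1) * f (0,2))
     + f (2,0) * (f (0,1) * f (1,2) - f (1,1) * (f (0,2) :: 'a :: comm_ring_1))"
  unfolding det_Suc_mat[of "Suc (Suc 0)"] det_mat_2 by (simp add: numeral_2_eq_2 algebra_simps)

text \<open>The resultant of $U^3 - aU^2 + bU - c$ and $p + qU + rU^2$; with these signs, $a$, $b$, $c$ are the
  elementary symmetric functions of the roots of the cubic.\<close>

definition resultant_3_2 :: "'a :: comm_ring_1 \<Rightarrow> 'a \<Rightarrow> 'a \<Rightarrow> 'a \<Rightarrow> 'a \<Rightarrow> 'a \<Rightarrow> 'a" where
  "resultant_3_2 a b c p q r = p^3 + a*p^2*q + (a^2 - 2*b)*p^2*r + b*p*q^2 + (a*b - 3*c)*p*q*r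
     + (b^2 - 2*a*c)*p*r^2 + c*q^3 + a*c*q^2*r + b*c*q*r^2 + c^2*r^3"

lemma resultant_monic_cubic_quadratic:
  fixes a b c p q r :: "'a :: comm_ring_1"
  assumes "r \<noteq> 0"
  shows "resultant [:- c, b, - a, 1:] [:p, q, r:] = resultant_3_2 a b c p q r"
proof -
  define f where "f = (\<lambda>(i,j).
     if i < 2 then if i \<le> j \<and> j - i \<le> 3 then coeff [:- c, b, - a, 1:] (3 + i - j) else 0
     else if i - 2 \<le> j \<and> j \<le> i then coeff [:p, q, r:] (i-j) else 0)"
  \<comment> \<open>The 25 entries of the Sylvester matrix are tabulated once, with the indices in
    the form in which the iterated Laplace expansion produces them.\<close>
  have f: "f (0, 0) = 1" "f (0, Suc 0) = - a" "f (0, 2) = b" "f (0, 3) = - c" "f (0, 4) = 0"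
    "f (Suc 0, 0) = 0" "f (Suc 0, Suc 0) = 1" "f (Suc 0, 2) = - a" "f (Suc 0, 3) = b" "f (Suc 0, 4) = - c"
    "f (2, 0) = r" "f (2, Suc 0) = q" "f (2, 2) = p" "f (2, 3) = 0" "f (2, 4) = 0"
    "f (3, 0) = 0" "f (3, Suc 0) = r" "f (3, 2) = q" "f (3, 3) = p" "f (3, 4) = 0"
    "f (4, 0) = 0" "f (4, Suc 0) = 0" "f (4, 2) = r" "f (4, 3) = q" "f (4, 4) = p"
    by (simp_all add: f_def eval_nat_numeral)
  have "resultant [:- c, b, - a, 1:] [:p, q, r:] = det (mat 5 5 f)"
    using assms by (simp add: resultant_def sylvester_mat_def sylvester_mat_sub_def f_def 
       numeral_2_eq_2[symmetric] numeral_3_eq_3[symmetric] split del: if_split cong: if_cong)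
  also have "mat 5 5 f = mat (Suc (Suc (Suc (Suc (Suc 0))))) (Suc (Suc (Suc (Suc (Suc 0))))) f"
    by (simp add: eval_nat_numeral)
  also have "det \<dots> = resultant_3_2 a b c p q r"
    unfolding det_Suc_mat[of "Suc (Suc (Suc (Suc 0)))"] det_Suc_mat[of "Suc (Suc (Suc 0))"] det_mat_3 
    apply simp
    apply (simp add: f numeral_2_eq_2[symmetric])
    apply (simp add: resultant_3_2_def algebra_simps eval_nat_numeral)
    done
  finally show ?thesis .
qed

section \<open>The sextic as an explicit polynomial in I, J, D and Lambda\<close>

interpretation qxy_to_closure: inj_comm_ring_hom qxy_to_closure
  by unfold_locales (auto simp: qxy_to_closure_def)

text \<open>The constant term in \<open>L\<close> is Disc_U C written out. The expanded form makes
  sense in any commutative ring, so evaluating it there does not involve transporting a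
  determinant.\<close>

definition res_sextic :: "'a :: comm_ring_1 \<Rightarrow> 'a \<Rightarrow> 'a \<Rightarrow> 'a \<Rightarrow> 'a" where
  "res_sextic I J D L = L ^ 6 - 4 * I * L ^ 5 + 2 * (3 * I ^ 2 + 8 * J) * L ^ 4
           - 4 * (I ^ 3 + 4 * I * J - 104 * D) * L ^ 3
           + (I ^ 4 - 16 * I ^ 2 * J - 448 * J ^ 2 - 384 * I * D) * L ^ 2
           + 16 * (I ^ 3 * J + 24 * I * J ^ 2 + 18 * I ^ 2 * D + 432 * J * D) * L
           + (64*I^2*J^2 + 2048*J^3 - 64*I^3*D - 6912*D^2 - 2304*I*J*D)"

lemma res_sextic_eq_resultant_3_2:
  "res_sextic I J D L = resultant_3_2 I (-(8 * J)) (16 * D) (L^2 - 2 * I * L + I^2 + 32 * J) (2 * L + 2 * I) (-3)"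
  by (simp add: resultant_3_2_def res_sextic_def eval_nat_numeral algebra_simps)

lemma cubicC_pCons: "cubicC = [:-(16 * calD), -(8 * invJ), -invI, 1:]"
  by (simp add: cubicC_def Let_def power3_eq_cube power2_eq_square)

lemma quarticQ_pCons:
  "quarticQ = [:[:[:1/16:]:] * invI ^ 2 + 2 * invJ, 4 * delta, [:[:-(1/2):]:] * invI, 0, 1:]"
proof -
  have "[:- (1/2 :: rat):] = - [:1/2:]" by simp
  then show ?thesis
    by (simp add: quarticQ_def Let_def eval_nat_numeral del: minus_pCons)
qed

text \<open>C' is a quadratic with leading coefficient 3, so the formula for Res(cubic, quadratic)
  applies to it as well. The sign is (-1)^3 and the division is by 1.\<close>

lemma discriminant_cubicC:
  "discriminant cubicC =
     64*invI^2*invJ^2 + 2048*invJ^3 - 64*invI^3*calD - 6912*calD^2 - 2304*invI*invJ*calD"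
proof -
  have "pderiv cubicC = [:-(8 * invJ), -(2 * invI), 3:]"
    by (simp add: cubicC_pCons pderiv_pCons)
  then have "discriminant cubicC = - resultant cubicC [:-(8 * invJ), -(2 * invI), 3:]"
    by (simp add: discriminant_def cubicC_pCons)
  also have "\<dots> = 64*invI^2*invJ^2 + 2048*invJ^3 - 64*invI^3*calD - 6912*calD^2 - 2304*invI*invJ*calD"
    unfolding cubicC_pCons
    by (subst resultant_monic_cubic_quadratic) (simp_all add: resultant_3_2_def eval_nat_numeral algebra_simps)
  finally show ?thesis .
qed

lemma quadratic_pCons: "[:L:] ^ 2 - 2 * ([:I:] - [:0, 1:]) * [:L:] + [:I:] ^ 2
       + 2 * [:I:] * [:0, 1:] - 3 * [:0, 1:] ^ 2 + 32 * [:J:]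
     = [:L^2 - 2 * I * L + I^2 + 32 * J, 2 * L + 2 * I, -3 :: 'a :: comm_ring_1:]"
  by (simp add: numeral_poly power2_eq_square algebra_simps)

text \<open>In U the second argument of the resultant has the leading coefficient -3, independent of
  Lambda, so the determinant formula applies over Q[X,Y][Lambda].\<close>

lemma calR_eq_res_sextic: "calR = res_sextic [:invI:] [:invJ:] [:calD:] [:0, 1:]"
proof -
  define I J D L :: "qxy poly" where "I = [:invI:]" and "J = [:invJ:]" and "D = [:calD:]" and "L = [:0, 1:]"
  have "map_poly (\<lambda>c. [:c:]) cubicC = [:-(16 * D), -(8 * J), -I, 1:]"
    by (simp add: cubicC_pCons map_poly_pCons I_def J_def D_def numeral_poly)
  moreover have "[:L:] ^ 2 - 2 * ([:I:] - [:0, 1:]) * [:L:] + [:I:] ^ 2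
       + 2 * [:I:] * [:0, 1:] - 3 * [:0, 1:] ^ 2 + 32 * [:J:]
     = [:L^2 - 2 * I * L + I^2 + 32 * J, 2 * L + 2 * I, -3:]"
    by (rule quadratic_pCons)
  ultimately have "calR = resultant [:-(16 * D), -(8 * J), -I, 1:]
      [:L^2 - 2 * I * L + I^2 + 32 * J, 2 * L + 2 * I, -3:]"
    unfolding calR_def Let_def I_def J_def L_def by (simp only:)
  also have "\<dots> = res_sextic I J D L"
    by (subst resultant_monic_cubic_quadratic) (simp_all add: res_sextic_eq_resultant_3_2)
  finally show ?thesis by (simp add: I_def J_def D_def L_def)
qed

lemma (in comm_ring_hom) hom_res_sextic:
  "hom (res_sextic I J D L) = res_sextic (hom I) (hom J) (hom D) (hom L)"
  by (simp add: res_sextic_def hom_numeral hom_add hom_minus hom_mult hom_power)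

lemma (in comm_ring_hom) poly_map_res_sextic:
  "poly (map_poly hom (res_sextic [:I:] [:J:] [:D:] [:0, 1:])) x
    = res_sextic (hom I) (hom J) (hom D) x"
proof -
  interpret p: map_poly_comm_ring_hom hom ..
  have "comm_ring_hom (\<lambda>p :: 'b poly. poly p x)"
    by unfold_locales auto
  note e = comm_ring_hom.hom_res_sextic[OF this]
  show ?thesis
    by (simp add: p.hom_res_sextic e map_poly_pCons_hom)
qed

text \<open>Each equation is linear in its own constant term, so \<open>c\<close> and
  \<open>p\<close> can be eliminated. What remains is an identity in U and the other coefficients,
  valid in every commutative ring.\<close>

lemma resultant_3_2_common_root:
  assumes "U ^ 3 - a * U ^ 2 + b * U - c = 0" "p + q * U + r * U ^ 2 = 0"
  shows "resultant_3_2 a b c p q r = 0"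
proof -
  have "c = U ^ 3 - a * U ^ 2 + b * U" "p = -(q * U + r * U ^ 2)"
    using assms by (simp_all only: right_minus_eq eq_neg_iff_add_eq_0 add.assoc)
  moreover have "resultant_3_2 a b (U ^ 3 - a * U ^ 2 + b * U) (-(q * U + r * U ^ 2)) q r = 0"
    by (simp add: resultant_3_2_def eval_nat_numeral algebra_simps)
  ultimately show ?thesis by simp
qed

lemma resultant_3_2_roots:
  "resultant_3_2 (u1 + u2 + u3) (u1*u2 + u1*u3 + u2*u3) (u1*u2*u3) p q r =
    (p + q * u1 + r * u1 ^ 2) * (p + q * u2 + r * u2 ^ 2) * (p + q * u3 + r * u3 ^ 2)"
  by (simp add: resultant_3_2_def eval_nat_numeral algebra_simps)

lemma res_sextic_common_root:
  assumes "U ^ 3 - I * U ^ 2 - 8 * J * U - 16 * D = 0"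
    and "L ^ 2 - 2 * (I - U) * L + I ^ 2 + 2 * I * U - 3 * U ^ 2 + 32 * J = 0"
  shows "res_sextic I J D L = 0"
  unfolding res_sextic_eq_resultant_3_2
proof (rule resultant_3_2_common_root[of U])
  show "U ^ 3 - I * U ^ 2 + -(8 * J) * U - 16 * D = 0"
    using assms(1) by simp
  have "L ^ 2 - 2 * I * L + I ^ 2 + 32 * J + (2 * L + 2 * I) * U + - 3 * U ^ 2
      = L ^ 2 - 2 * (I - U) * L + I ^ 2 + 2 * I * U - 3 * U ^ 2 + 32 * J"
    by (simp add: algebra_simps)
  also have "\<dots> = 0" by (fact assms(2))
  finally show "L ^ 2 - 2 * I * L + I ^ 2 + 32 * J + (2 * L + 2 * I) * U + - 3 * U ^ 2 = 0" .
qed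

lemma const_poly_discriminant:
  fixes i j d :: "'a :: comm_ring_1"
  shows "[:64 * i^2 * j^2 + 2048 * j^3 - 64 * i^3 * d - 6912 * d^2 - 2304 * i * j * d:] =
    64 * [:i:]^2 * [:j:]^2 + 2048 * [:j:]^3 - 64 * [:i:]^3 * [:d:] - 6912 * [:d:]^2 - 2304 * [:i:] * [:j:] * [:d:]"
  by (simp add: numeral_poly power2_eq_square power3_eq_cube mult_ac)

text \<open>That R(0) = Disc_U C reflects the equality of the discriminants of a quartic and its
  resolvent cubic: R(0) is the product of all (t_i - t_j)^2. Here it is read off from the two
  expanded forms.\<close>

lemma calR_explicit:
  "calR =
       (let L = [:0, 1:]; I = [:invI:]; J = [:invJ:]; D = [:calD:]
        in L ^ 6 - 4 * I * L ^ 5 + 2 * (3 * I ^ 2 + 8 * J) * L ^ 4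
           - 4 * (I ^ 3 + 4 * I * J - 104 * D) * L ^ 3
           + (I ^ 4 - 16 * I ^ 2 * J - 448 * J ^ 2 - 384 * I * D) * L ^ 2
           + 16 * (I ^ 3 * J + 24 * I * J ^ 2 + 18 * I ^ 2 * D + 432 * J * D) * L
           + [:discriminant cubicC:])"
  unfolding calR_eq_res_sextic res_sextic_def discriminant_cubicC Let_def const_poly_discriminant ..

section \<open>The roots of the sextic\<close>

text \<open>The roots of C are the squares of z1, z2, z3. At U = z1^2 the quadratic in Lambda has
  root sum 2 (z2^2 + z3^2) and root product (z2^2 - z3^2)^2, so it splits into (z2 + z3)^2 and (z2 -
  z3)^2; likewise at the other two roots.\<close>

lemma res_sextic_resolvent:
  fixes z1 z2 z3 L :: "'a :: comm_ring_1"
  assumes I: "I = z1^2 + z2^2 + z3^2" and J: "-(8 * J) = z1^2*z2^2 + z1^2*z3^2 + z2^2*z3^2"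
    and D: "16 * D = z1^2*z2^2*z3^2"
  shows "res_sextic I J D L =
     (L - (z1 + z2)^2) * (L - (z1 - z2)^2) * (L - (z1 + z3)^2) * (L - (z1 - z3)^2) *
     (L - (z2 + z3)^2) * (L - (z2 - z3)^2)"
proof -
  have "32 * J = -(4 * (-(8 * J)))" by simp
  then have J': "32 * J = -(4 * (z1^2*z2^2 + z1^2*z3^2 + z2^2*z3^2))"
    unfolding J .
  have *: "L^2 - 2 * I * L + I^2 + 32 * J + (2 * L + 2 * I) * z1^2 + (-3) * (z1^2)^2
      = (L - (z2 + z3)^2) * (L - (z2 - z3)^2)"
    "L^2 - 2 * I * L + I^2 + 32 * J + (2 * L + 2 * I) * z2^2 + (-3) * (z2^2)^2
      = (L - (z1 + z3)^2) * (L - (z1 - z3)^2)"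
    "L^2 - 2 * I * L + I^2 + 32 * J + (2 * L + 2 * I) * z3^2 + (-3) * (z3^2)^2
      = (L - (z1 + z2)^2) * (L - (z1 - z2)^2)"
    unfolding I J' by (simp_all add: eval_nat_numeral algebra_simps)
  have "res_sextic I J D L = resultant_3_2 (z1^2 + z2^2 + z3^2) (z1^2*z2^2 + z1^2*z3^2 + z2^2*z3^2) (z1^2*z2^2*z3^2)
      (L^2 - 2 * I * L + I^2 + 32 * J) (2 * L + 2 * I) (-3)"
    by (simp only: res_sextic_eq_resultant_3_2 J D flip: I)
  also have "\<dots> = ((L - (z2 + z3)^2) * (L - (z2 - z3)^2)) * ((L - (z1 + z3)^2) * (L - (z1 - z3)^2))
      * ((L - (z1 + z2)^2) * (L - (z1 - z2)^2))"
    by (simp only: resultant_3_2_roots *)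
  finally show ?thesis by (simp only: mult_ac)
qed

section \<open>Root multisets and the relations of Vieta\<close>

lemma proots_prod_mset_linear:
  fixes A :: "'a :: idom multiset"
  shows "proots (\<Prod>x\<in>#A. [:- x, 1:]) = A"
proof (induction A)
  case (add x A)
  have "(\<Prod>x\<in>#A. [:- x, 1:]) \<noteq> 0"
    by (auto simp: prod_mset_zero_iff)
  with add show ?case
    by (simp add: proots_mult del: mult_pCons_left)
qed simp

lemma prod_mset_proots:
  fixes p :: "'a :: alg_closed_field poly"
  assumes "lead_coeff p = 1"
  shows "(\<Prod>x\<in>#proots p. [:- x, 1:]) = p"
proof -
  from assms have "p \<noteq> 0" by auto
  from alg_closed_imp_factorization[OF this] assms
  obtain A where "p = (\<Prod>x\<in>#A. [:- x, 1:])" by auto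
  then show ?thesis by (metis proots_prod_mset_linear)
qed

lemma qxy_to_closure_const:
  "qxy_to_closure [:[:1 / numeral n:]:] = 1 / numeral n"
proof -
  have "qxy_to_closure [:[:1 / numeral n:]:] * numeral n
      = qxy_to_closure ([:[:1 / numeral n:]:] * numeral n)"
    by (simp only: qxy_to_closure.hom_mult qxy_to_closure.hom_numeral)
  also have "[:[:1 / numeral n:]:] * numeral n = (1 :: qxy)"
    by (simp add: numeral_poly one_pCons)
  finally show ?thesis by (simp add: field_simps)
qed

lemma mset_set_1_4: "mset_set {1..4 :: nat} = {#1, 2, 3, 4#}"
proof -
  have "{1..4 :: nat} = {1, 2, 3, 4}" by auto
  then show ?thesis by simp
qed

lemma mset_set_pairs_1_4:
  "mset_set {(i, j). 1 \<le> i \<and> i < j \<and> j \<le> (4 :: nat)} =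
     {#(1, 2), (1, 3), (1, 4), (2, 3), (2, 4), (3, 4)#}"
proof -
  have "{(i, j). 1 \<le> i \<and> i < j \<and> j \<le> (4 :: nat)} =
      {(1, 2), (1, 3), (1, 4), (2, 3), (2, 4), (3, 4)}" by auto
  then show ?thesis by simp
qed

lemma quarticQ_vieta:
  fixes t :: "nat \<Rightarrow> qxy_closure"
  assumes "proots (map_poly qxy_to_closure quarticQ) = image_mset t (mset_set {1..4})"
  shows "t 1 + t 2 + t 3 + t 4 = 0"
    and "qxy_to_closure invI =
      -2 * (t 1 * t 2 + t 1 * t 3 + t 1 * t 4 + t 2 * t 3 + t 2 * t 4 + t 3 * t 4)"
    and "4 * qxy_to_closure delta =
      -(t 1 * t 2 * t 3 + t 1 * t 2 * t 4 + t 1 * t 3 * t 4 + t 2 * t 3 * t 4)"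
    and "qxy_to_closure invI ^ 2 / 16 + 2 * qxy_to_closure invJ = t 1 * t 2 * t 3 * t 4"
proof -
  define q where "q = [:qxy_to_closure invI ^ 2 / 16 + 2 * qxy_to_closure invJ,
      4 * qxy_to_closure delta, - (qxy_to_closure invI / 2), 0, 1:]"
  have m: "[:[:- (1/2):]:] = - ([:[:1/2:]:] :: qxy)" by simp
  have "map_poly qxy_to_closure quarticQ = q"
    unfolding quarticQ_pCons q_def m
    by (simp add: map_poly_pCons hom_distribs qxy_to_closure_const del: minus_pCons mult_pCons_left)
  with assms have "q = (\<Prod>x\<in>#image_mset t (mset_set {1..4}). [:- x, 1:])"
    using prod_mset_proots[of q] by (simp add: q_def)
  also have "\<dots> = [:- t 1, 1:] * [:- t 2, 1:] * [:- t 3, 1:] * [:- t 4, 1:]"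
    by (simp only: mset_set_1_4 image_mset_add_mset image_mset_empty prod_mset.add_mset prod_mset.empty
         mult_1_right mult.assoc)
  also have "\<dots> = [:t 1 * t 2 * t 3 * t 4,
       -(t 1 * t 2 * t 3 + t 1 * t 2 * t 4 + t 1 * t 3 * t 4 + t 2 * t 3 * t 4),
       t 1 * t 2 + t 1 * t 3 + t 1 * t 4 + t 2 * t 3 + t 2 * t 4 + t 3 * t 4,
       -(t 1 + t 2 + t 3 + t 4), 1:]"
    by (simp add: algebra_simps)
  finally have eqs: "qxy_to_closure invI ^ 2 / 16 + 2 * qxy_to_closure invJ = t 1 * t 2 * t 3 * t 4"
    "4 * qxy_to_closure delta = -(t 1 * t 2 * t 3 + t 1 * t 2 * t 4 + t 1 * t 3 * t 4 + t 2 * t 3 * t 4)"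
    "- (qxy_to_closure invI / 2) = t 1 * t 2 + t 1 * t 3 + t 1 * t 4 + t 2 * t 3 + t 2 * t 4 + t 3 * t 4"
    "-(t 1 + t 2 + t 3 + t 4) = 0"
    unfolding q_def by (simp_all only: pCons_eq_iff)
  show "t 1 + t 2 + t 3 + t 4 = 0"
    using eqs(4) by (simp only: neg_equal_0_iff_equal)
  show "qxy_to_closure invI =
      -2 * (t 1 * t 2 + t 1 * t 3 + t 1 * t 4 + t 2 * t 3 + t 2 * t 4 + t 3 * t 4)"
    unfolding eqs(3)[symmetric] by simp
  show "4 * qxy_to_closure delta =
      -(t 1 * t 2 * t 3 + t 1 * t 2 * t 4 + t 1 * t 3 * t 4 + t 2 * t 3 * t 4)"
    by (fact eqs(2))
  show "qxy_to_closure invI ^ 2 / 16 + 2 * qxy_to_closure invJ = t 1 * t 2 * t 3 * t 4"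
    by (fact eqs(1))
qed

lemma delta_nonzero: "delta \<noteq> 0"
  by (simp add: delta_def varX_def varY_def one_pCons)

text \<open>As c + d = -(a + b), the third symmetric function factors and 4 \<delta> = (a + b)(a b -
  c d). Hence \<delta> \<noteq> 0 excludes a + b = 0, and 8 \<delta> / (a + b) is 2 (a b - c
  d).\<close>

lemma edge_relation:
  fixes a b c d I \<delta> :: "'a :: field_char_0"
  assumes "a + b + c + d = 0" "I = -2 * (a*b + a*c + a*d + b*c + b*d + c*d)"
    "4 * \<delta> = -(a*b*c + a*b*d + a*c*d + b*c*d)" "\<delta> \<noteq> 0"
  shows "a + b \<noteq> 0 \<and> (a - b)^2 = I - (a + b)^2 - 8 * \<delta> / (a + b)"
proof -
  have d: "d = -(a + b) - c"
    using assms(1) by (simp add: eq_neg_iff_add_eq_0 algebra_simps)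
  have \<delta>: "4 * \<delta> = (a + b) * (a*b - c*d)"
    unfolding assms(3) d by (simp add: algebra_simps)
  with assms(4) have nz: "a + b \<noteq> 0" by auto
  have "8 * \<delta> / (a + b) = 2 * (4 * \<delta>) / (a + b)" by simp
  also have "\<dots> = 2 * (a*b - c*d)" unfolding \<delta> using nz by simp
  also have "I - (a + b)^2 - 2 * (a*b - c*d) = (a - b)^2"
    unfolding assms(2) d by (simp add: algebra_simps power2_eq_square)
  finally show ?thesis using nz by metis
qed

lemma proots_calR:
  fixes t :: "nat \<Rightarrow> qxy_closure"
  assumes "proots (map_poly qxy_to_closure quarticQ) = image_mset t (mset_set {1..4})"
  shows "proots (map_poly qxy_to_closure calR) =
          image_mset (\<lambda>(i, j). (t i - t j) ^ 2) (mset_set {(i, j). 1 \<le> i \<and> i < j \<and> j \<le> 4})"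
proof -
  note v = quarticQ_vieta[OF assms]
  define z1 z2 z3 where "z1 = t 1 + t 2" "z2 = t 1 + t 3" "z3 = t 1 + t 4"
  note z = z1_z2_z3_def
  have t4: "t 4 = -(t 1 + t 2 + t 3)"
    using v(1) by (simp add: eq_neg_iff_add_eq_0 algebra_simps)
  have I: "qxy_to_closure invI = z1^2 + z2^2 + z3^2"
    unfolding v(2) z t4 by (simp add: algebra_simps power2_eq_square)
  have "-(8 * qxy_to_closure invJ) = (qxy_to_closure invI / 2) ^ 2 - 4 * (t 1 * t 2 * t 3 * t 4)"
    unfolding v(4)[symmetric] by (simp add: power2_eq_square)
  then have J: "-(8 * qxy_to_closure invJ) = z1^2*z2^2 + z1^2*z3^2 + z2^2*z3^2"
    unfolding v(2) z t4 by (simp add: algebra_simps power2_eq_square)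
  \<comment> \<open>Vieta gives 4 \<delta> = - z1 z2 z3; the sign disappears in D =
    \<delta>^2.\<close>
  have "16 * qxy_to_closure calD = (4 * qxy_to_closure delta) ^ 2"
    by (simp add: calD_def hom_distribs power_mult_distrib)
  then have D: "16 * qxy_to_closure calD = z1^2*z2^2*z3^2"
    unfolding v(3) z t4 by (simp add: algebra_simps power2_eq_square)
  have "proots (map_poly qxy_to_closure calR) = {#(z1 + z2)^2, (z1 - z2)^2, (z1 + z3)^2, (z1 - z3)^2,
      (z2 + z3)^2, (z2 - z3)^2#}" (is "_ = ?A")
  proof -
    interpret p: map_poly_comm_ring_hom qxy_to_closure ..
    have "map_poly qxy_to_closure calR = res_sextic [:qxy_to_closure invI:] [:qxy_to_closure invJ:]
        [:qxy_to_closure calD:] [:0, 1:]"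
      by (simp add: calR_eq_res_sextic p.hom_res_sextic qxy_to_closure.map_poly_pCons_hom)
    also have "\<dots> = ([:0, 1:] - ([:z1:] + [:z2:])^2) * ([:0, 1:] - ([:z1:] - [:z2:])^2)
       * ([:0, 1:] - ([:z1:] + [:z3:])^2) * ([:0, 1:] - ([:z1:] - [:z3:])^2)
       * ([:0, 1:] - ([:z2:] + [:z3:])^2) * ([:0, 1:] - ([:z2:] - [:z3:])^2)"
    proof (rule res_sextic_resolvent)
      show "[:qxy_to_closure invI:] = [:z1:]\<^sup>2 + [:z2:]\<^sup>2 + [:z3:]\<^sup>2"
        by (simp add: I power2_eq_square)
      have "- (8 * [:qxy_to_closure invJ:]) = [:-(8 * qxy_to_closure invJ):]"
        by (simp add: numeral_poly)
      also have "\<dots> = [:z1:]\<^sup>2 * [:z2:]\<^sup>2 + [:z1:]\<^sup>2 * [:z3:]\<^sup>2 + [:z2:]\<^sup>2 * [:z3:]\<^sup>2"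
        unfolding J by (simp add: power2_eq_square)
      finally show "- (8 * [:qxy_to_closure invJ:]) =
          [:z1:]\<^sup>2 * [:z2:]\<^sup>2 + [:z1:]\<^sup>2 * [:z3:]\<^sup>2 + [:z2:]\<^sup>2 * [:z3:]\<^sup>2" .
      have "16 * [:qxy_to_closure calD:] = [:16 * qxy_to_closure calD:]"
        by (simp add: numeral_poly)
      also have "\<dots> = [:z1:]\<^sup>2 * [:z2:]\<^sup>2 * [:z3:]\<^sup>2"
        unfolding D by (simp add: power2_eq_square)
      finally show "16 * [:qxy_to_closure calD:] = [:z1:]\<^sup>2 * [:z2:]\<^sup>2 * [:z3:]\<^sup>2" .
    qed
    also have "\<dots> = (\<Prod>x\<in>#?A. [:- x, 1:])"
    proof -
      have "[:0, 1:] - ([:a:] + [:b:])^2 = [:- ((a + b)^2), 1:]"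
        "[:0, 1:] - ([:a:] - [:b:])^2 = [:- ((a - b)^2), 1:]" for a b :: qxy_closure
        by (simp_all add: power2_eq_square)
      then show ?thesis
        by (simp only: image_mset_add_mset image_mset_empty prod_mset.add_mset prod_mset.empty
         mult_1_right mult.assoc)
    qed
    finally show ?thesis by (simp only: proots_prod_mset_linear)
  qed
  \<comment> \<open>Because the roots sum to zero, each sum or difference of two of the z's is a
    difference of two roots, and every pair of indices occurs exactly once.\<close>
  moreover have "z1 + z2 = t 1 - t 4" "z1 - z2 = t 2 - t 3" "z1 + z3 = t 1 - t 3"
    "z1 - z3 = t 2 - t 4" "z2 + z3 = t 1 - t 2" "z2 - z3 = t 3 - t 4"
    by (simp_all add: z t4)
  ultimately show ?thesis
    unfolding mset_set_pairs_1_4 by (simp add: add_mset_commute)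
qed

text \<open>The relations of Vieta are symmetric, so the complementary pair of indices can play the
  roles of c and d in \<open>edge_relation\<close>.\<close>

lemma quarticQ_edge:
  fixes t :: "nat \<Rightarrow> qxy_closure"
  assumes "proots (map_poly qxy_to_closure quarticQ) = image_mset t (mset_set {1..4})"
    and "1 \<le> i" "i < j" "j \<le> 4"
  shows "t i + t j \<noteq> 0 \<and> (t i - t j)^2 =
     qxy_to_closure invI - (t i + t j)^2 - 8 * qxy_to_closure delta / (t i + t j)"
proof -
  note v = quarticQ_vieta[OF assms(1)]
  have nz: "qxy_to_closure delta \<noteq> 0"
    using delta_nonzero by simp
  have "(i, j) \<in> {(1, 2), (1, 3), (1, 4), (2, 3), (2, 4), (3, 4)}"
    using assms(2-4) by auto
  then obtain k l where "t i + t j + t k + t l = 0"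
    "qxy_to_closure invI = -2 * (t i * t j + t i * t k + t i * t l + t j * t k + t j * t l + t k * t l)"
    "4 * qxy_to_closure delta =
      -(t i * t j * t k + t i * t j * t l + t i * t k * t l + t j * t k * t l)"
  proof (elim insertE emptyE Pair_inject)
    assume ij: "i = 1" "j = 2"
    show ?thesis
      by (rule that[of 3 4]; unfold ij; use v in \<open>simp only: ac_simps\<close>)
  next
    assume ij: "i = 1" "j = 3"
    show ?thesis
      by (rule that[of 2 4]; unfold ij; use v in \<open>simp only: ac_simps\<close>)
  next
    assume ij: "i = 1" "j = 4"
    show ?thesis
      by (rule that[of 2 3]; unfold ij; use v in \<open>simp only: ac_simps\<close>)
  next
    assume ij: "i = 2" "j = 3"
    show ?thesis
      by (rule that[of 1 4]; unfold ij; use v in \<open>simp only: ac_simps\<close>)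
  next
    assume ij: "i = 2" "j = 4"
    show ?thesis
      by (rule that[of 1 3]; unfold ij; use v in \<open>simp only: ac_simps\<close>)
  next
    assume ij: "i = 3" "j = 4"
    show ?thesis
      by (rule that[of 1 2]; unfold ij; use v in \<open>simp only: ac_simps\<close>)
  qed
  from edge_relation[OF this nz] show ?thesis .
qed

text \<open>The hypotheses are 16 Q_4 = 0 at both roots. Their difference is divisible by t1 - t2
  and yields the edge relation 8 \<delta> = (t1 + t2)(I - U - L) without a division; their sum then
  gives the quadratic. Squaring the edge relation and inserting the quadratic gives C(U) =
  0.\<close>

lemma common_root_relations:
  fixes t1 t2 I J \<delta> :: "'a :: {idom, semiring_char_0}"
  assumes 1: "16 * t1^4 - 8 * I * t1^2 + 64 * \<delta> * t1 + I^2 + 32 * J = 0"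
    and 2: "16 * t2^4 - 8 * I * t2^2 + 64 * \<delta> * t2 + I^2 + 32 * J = 0"
    and neq: "t1 \<noteq> t2"
  defines "U \<equiv> (t1 + t2)^2" and "L \<equiv> (t1 - t2)^2"
  shows "U^3 - I * U^2 - 8 * J * U - 16 * \<delta>^2 = 0"
    and "L ^ 2 - 2 * (I - U) * L + I ^ 2 + 2 * I * U - 3 * U ^ 2 + 32 * J = 0"
proof -
  have "8 * ((t1 - t2) * (8 * \<delta> - (t1 + t2) * (I - U - L))) =
     (16 * t1^4 - 8 * I * t1^2 + 64 * \<delta> * t1 + I^2 + 32 * J)
     - (16 * t2^4 - 8 * I * t2^2 + 64 * \<delta> * t2 + I^2 + 32 * J)"
    unfolding U_def L_def by (simp add: eval_nat_numeral algebra_simps)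
  with 1 2 neq have \<delta>: "8 * \<delta> = (t1 + t2) * (I - U - L)" by simp
  have "2 * (L ^ 2 - 2 * (I - U) * L + I ^ 2 + 2 * I * U - 3 * U ^ 2 + 32 * J) =
     (16 * t1^4 - 8 * I * t1^2 + 64 * \<delta> * t1 + I^2 + 32 * J)
     + (16 * t2^4 - 8 * I * t2^2 + 64 * \<delta> * t2 + I^2 + 32 * J)
     - 8 * (t1 + t2) * (8 * \<delta> - (t1 + t2) * (I - U - L))"
    unfolding U_def L_def by (simp add: eval_nat_numeral algebra_simps)
  also have "\<dots> = 0" unfolding 1 2 \<delta> by simp
  finally show G: "L ^ 2 - 2 * (I - U) * L + I ^ 2 + 2 * I * U - 3 * U ^ 2 + 32 * J = 0"
    by (simp only: mult_eq_0_iff) simp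
  have "4 * (U^3 - I * U^2 - 8 * J * U - 16 * \<delta>^2) = 4 * U^3 - 4 * I * U^2 - 32 * J * U - (8 * \<delta>)^2"
    by (simp add: power2_eq_square algebra_simps)
  also have "\<dots> = U * (4 * U^2 - 4 * I * U - 32 * J - (I - U - L)^2)"
    unfolding \<delta> by (simp add: U_def[symmetric] power_mult_distrib) (simp add: eval_nat_numeral algebra_simps)
  also have "4 * U^2 - 4 * I * U - 32 * J - (I - U - L)^2 =
      - (L ^ 2 - 2 * (I - U) * L + I ^ 2 + 2 * I * U - 3 * U ^ 2 + 32 * J)"
    by (simp add: power2_eq_square algebra_simps)
  finally show "U^3 - I * U^2 - 8 * J * U - 16 * \<delta>^2 = 0"
    unfolding G by (simp only: mult_eq_0_iff minus_zero mult_zero_right) simp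
qed

section \<open>Lagrange inversion\<close>

text \<open>With G = X \<psi> the coefficient is the residue of G'/G^m. For m = 1 this is a
  logarithmic derivative with residue 1; for m > 1 it is the derivative of G^(1-m)/(1-m), which has
  residue 0. The proof phrases this with powers of \<phi> = 1/\<psi> in place of negative powers of
  G.\<close>

lemma lagrange_residue:
  fixes \<phi> \<psi> :: "'a :: field_char_0 fps"
  assumes "\<psi> * \<phi> = 1" and "m > 0"
  shows "(\<phi> ^ m * fps_deriv (fps_X * \<psi>)) $ (m - 1) = (if m = 1 then 1 else 0)"
proof -
  obtain k where m: "m = Suc k" using \<open>m > 0\<close> by (cases m) auto
  have "fps_deriv \<psi> * \<phi> + \<psi> * fps_deriv \<phi> = 0"
    using arg_cong[OF assms(1), of fps_deriv] by (simp add: add.commute)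
  then have d: "fps_deriv \<psi> * \<phi> = - (\<psi> * fps_deriv \<phi>)"
    by (simp add: eq_neg_iff_add_eq_0)
  have "\<phi> ^ m * fps_deriv (fps_X * \<psi>) = \<phi> ^ k * (\<psi> * \<phi>) + fps_X * \<phi> ^ k * (fps_deriv \<psi> * \<phi>)"
    by (simp add: m algebra_simps)
  also have "\<dots> = \<phi> ^ k - fps_X * (\<phi> ^ k * \<psi> * fps_deriv \<phi>)"
    unfolding assms(1) d by (simp add: mult_ac)
  finally have eq: "\<phi> ^ m * fps_deriv (fps_X * \<psi>) = \<phi> ^ k - fps_X * (\<phi> ^ k * \<psi> * fps_deriv \<phi>)" .
  show ?thesis
  proof (cases k)
    case 0
    then show ?thesis unfolding eq by (simp add: m)
  next
    case (Suc l)
    have "\<phi> ^ k * \<psi> * fps_deriv \<phi> = \<phi> ^ l * (\<psi> * \<phi>) * fps_deriv \<phi>"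
      by (simp add: Suc mult_ac)
    \<comment> \<open>The relation \<psi> \<phi> = 1 turns the product into \<phi>^(k-1) \<phi>', a
      k-th part of the derivative of \<phi>^k.\<close>
    then have "fps_const (of_nat k) * (\<phi> ^ k * \<psi> * fps_deriv \<phi>) = fps_deriv (\<phi> ^ k)"
      by (simp only: fps_deriv_power assms(1)) (simp add: Suc mult_ac)
    then have "of_nat k * ((\<phi> ^ k * \<psi> * fps_deriv \<phi>) $ l) = of_nat k * (\<phi> ^ k) $ k"
      by (metis Suc Suc_eq_plus1 fps_deriv_nth fps_mult_left_const_nth)
    then have "(\<phi> ^ k * \<psi> * fps_deriv \<phi>) $ l = (\<phi> ^ k) $ k"
      using Suc by (metis mult_left_cancel of_nat_0_eq_iff nat.distinct(1))
    then show ?thesis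
      unfolding eq by (simp add: m Suc)
  qed
qed

text \<open>The formula involves F only through its composition with X \<psi>, which is the known
  series when F is defined by inverting X \<psi>.\<close>

lemma fps_lagrange_inversion:
  fixes \<phi> \<psi> F :: "'a :: field_char_0 fps"
  assumes "\<psi> * \<phi> = 1" and "n > 0"
  shows "of_nat n * F $ n = (fps_deriv (F oo (fps_X * \<psi>)) * \<phi> ^ n) $ (n - 1)"
proof -
  define G where "G = fps_X * \<psi>"
  define D where "D = fps_deriv F"
  define R where "R = fps_shift n D"
  have G0: "G $ 0 = 0" by (simp add: G_def)
  have pw: "G ^ j * \<phi> ^ n = fps_X ^ j * \<phi> ^ (n - j)" if "j \<le> n" for j
  proof -
    have "G ^ j * \<phi> ^ n = fps_X ^ j * (\<psi> * \<phi>) ^ j * \<phi> ^ (n - j)"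
      using that by (simp add: G_def power_mult_distrib mult_ac flip: power_add)
    then show ?thesis by (simp add: assms(1))
  qed
  \<comment> \<open>Cutting F' at degree n leaves a finite sum. The tail acquires the factor X^n and
    cannot reach degree n - 1; in the sum only j = n - 1 has a nonzero residue.\<close>
  have D: "D = R * fps_X ^ n + (\<Sum>j<n. fps_const (D $ j) * fps_X ^ j)"
    by (rule fps_ext) (auto simp: R_def fps_sum_nth fps_X_power_mult_right_nth if_distrib cong: if_cong)
  have "fps_deriv (F oo G) * \<phi> ^ n = (D oo G) * fps_deriv G * \<phi> ^ n"
    by (simp add: fps_compose_deriv[OF G0] D_def)
  also have "D oo G = (R oo G) * G ^ n + (\<Sum>j<n. fps_const (D $ j) * G ^ j)"
    by (subst D) (simp add: fps_compose_add_distrib fps_compose_mult_distrib[OF G0]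
        fps_compose_sum_distrib fps_compose_power[OF G0, symmetric] G0)
  also have "((R oo G) * G ^ n + (\<Sum>j<n. fps_const (D $ j) * G ^ j)) * fps_deriv G * \<phi> ^ n
    = (R oo G) * fps_deriv G * (G ^ n * \<phi> ^ n) + (\<Sum>j<n. fps_const (D $ j) * (fps_deriv G * (G ^ j * \<phi> ^ n)))"
    by (simp add: algebra_simps sum_distrib_left)
  also have "\<dots> = (R oo G) * fps_deriv G * fps_X ^ n
      + (\<Sum>j<n. fps_const (D $ j) * (fps_X ^ j * (\<phi> ^ (n - j) * fps_deriv G)))"
    by (simp add: pw mult_ac)
  also have "\<dots> $ (n - 1) = (\<Sum>j<n. D $ j * (if j = n - 1 then 1 else 0))"
  proof -
    have "(fps_X ^ j * (\<phi> ^ (n - j) * fps_deriv G)) $ (n - 1) = (if j = n - 1 then 1 else 0)"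
      if "j < n" for j
    proof -
      have "(fps_X ^ j * (\<phi> ^ (n - j) * fps_deriv G)) $ (n - 1) = (\<phi> ^ (n - j) * fps_deriv G) $ (n - j - 1)"
        using that by (auto simp: fps_X_power_mult_nth intro!: arg_cong[of _ _ "fps_nth _"])
      then show ?thesis
        using lagrange_residue[OF assms(1), of "n - j"] that unfolding G_def by auto
    qed
    then show ?thesis
      using \<open>n > 0\<close> by (simp add: fps_sum_nth fps_X_power_mult_right_nth)
  qed
  also have "\<dots> = D $ (n - 1)"
    using \<open>n > 0\<close> by (simp add: sum.delta if_distrib cong: if_cong)
  also have "\<dots> = of_nat n * F $ n"
    using \<open>n > 0\<close> by (simp add: D_def)
  finally show ?thesis by (simp add: G_def)
qed

section \<open>Embeddings of the power series ring\<close>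

text \<open>Rereads a series in $X$ over $Q[[b]]$ as a series in $b$ over the field $Q((X))$:
  compositional inverses are only available over a field.\<close>

definition swap_to_fls :: "rat fps fps \<Rightarrow> rat fls fps" where
  "swap_to_fls f = Abs_fps (\<lambda>n. fps_to_fls (Abs_fps (\<lambda>m. f $ m $ n)))"

text \<open>The outer variable of the target is y = sqrt Y. The target is the ring containing both
  branches, and injectivity brings identities back to Q[[X,Y]].\<close>

definition subst_square :: "rat fps fps \<Rightarrow> rat fls fps" where
  "subst_square f = Abs_fps (\<lambda>n. if even n then fps_to_fls (f $ (n div 2)) else 0)"

lemma fps_to_fls_sum: "fps_to_fls (\<Sum>i\<in>A. f i) = (\<Sum>i\<in>A. fps_to_fls (f i :: 'a :: comm_ring_1 fps))"
  by (induction A rule: infinite_finite_induct) auto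

interpretation swap_to_fls: comm_ring_hom swap_to_fls
proof
  show "swap_to_fls (f * g) = swap_to_fls f * swap_to_fls g" for f g
  proof (rule fps_ext)
    fix n
    have "Abs_fps (\<lambda>m. (f * g) $ m $ n) =
       (\<Sum>i=0..n. Abs_fps (\<lambda>m. f $ m $ i) * Abs_fps (\<lambda>m. g $ m $ (n - i)))"
    proof (rule fps_ext)
      fix m
      show "Abs_fps (\<lambda>m. (f * g) $ m $ n) $ m =
         (\<Sum>i=0..n. Abs_fps (\<lambda>m. f $ m $ i) * Abs_fps (\<lambda>m. g $ m $ (n - i))) $ m"
        by (simp add: fps_mult_nth fps_sum_nth) (rule sum.swap)
    qed
    then show "swap_to_fls (f * g) $ n = (swap_to_fls f * swap_to_fls g) $ n"
      by (simp add: swap_to_fls_def fps_mult_nth fps_to_fls_sum fls_times_fps_to_fls)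
  qed
  show "swap_to_fls 1 = 1"
    by (rule fps_ext) (auto simp: swap_to_fls_def fps_eq_iff intro!: fps_ext)
  show "swap_to_fls 0 = 0"
    by (rule fps_ext) (auto simp: swap_to_fls_def fps_eq_iff)
  show "swap_to_fls (f + g) = swap_to_fls f + swap_to_fls g" for f g
  proof (rule fps_ext)
    fix n
    have "Abs_fps (\<lambda>m. (f + g) $ m $ n) = Abs_fps (\<lambda>m. f $ m $ n) + Abs_fps (\<lambda>m. g $ m $ n)"
      by (rule fps_ext) simp
    then show "swap_to_fls (f + g) $ n = (swap_to_fls f + swap_to_fls g) $ n"
      by (simp add: swap_to_fls_def)
  qed
qed

interpretation subst_square: inj_comm_ring_hom subst_square
proof
  show "subst_square (f * g) = subst_square f * subst_square g" for f g
  proof (rule fps_ext)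
    fix n
    show "subst_square (f * g) $ n = (subst_square f * subst_square g) $ n"
    proof (cases "even n")
      case True
      then obtain k where n: "n = 2 * k" by auto
      have "(subst_square f * subst_square g) $ n =
         (\<Sum>i\<in>{i\<in>{0..n}. even i}. fps_to_fls (f $ (i div 2) * g $ ((n - i) div 2)))"
        unfolding fps_mult_nth sum.inter_filter[OF finite_atLeastAtMost]
        by (rule sum.cong) (auto simp: subst_square_def n fls_times_fps_to_fls)
      also have "\<dots> = (\<Sum>i=0..k. fps_to_fls (f $ i * g $ (k - i)))"
        by (rule sum.reindex_bij_witness[of _ "\<lambda>i. 2 * i" "\<lambda>i. i div 2"]) (auto simp: n simp flip: right_diff_distrib' elim!: evenE)
      finally show ?thesis
        by (simp add: subst_square_def n fps_mult_nth fps_to_fls_sum)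
    next
      case False
      then have "subst_square f $ i * subst_square g $ (n - i) = 0" if "i \<le> n" for i
        using that by (auto simp: subst_square_def)
      then have "(subst_square f * subst_square g) $ n = 0"
        unfolding fps_mult_nth by (intro sum.neutral) simp
      with False show ?thesis
        by (simp add: subst_square_def)
    qed
  qed
  show "subst_square 1 = 1"
    by (rule fps_ext) (auto simp: subst_square_def elim: evenE)
  show "subst_square 0 = 0"
    by (rule fps_ext) (simp add: subst_square_def)
  show "subst_square (f + g) = subst_square f + subst_square g" for f g
    by (rule fps_ext) (simp add: subst_square_def)
  show "f = 0" if "subst_square f = 0" for f
  proof (rule fps_ext)
    fix n
    have "subst_square f $ (2 * n) = 0" using that by simp
    then show "f $ n = 0 $ n" by (simp add: subst_square_def)
  qed
qed

interpretation fps_of_poly: comm_ring_hom "fps_of_poly :: 'a :: comm_ring_1 poly \<Rightarrow> _"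
  by unfold_locales (simp_all add: fps_of_poly_add fps_of_poly_mult)

interpretation qxy_to_series: comm_ring_hom qxy_to_series
proof -
  interpret m: map_poly_comm_ring_hom "fps_of_poly :: rat poly \<Rightarrow> _" ..
  show "comm_ring_hom qxy_to_series"
    by unfold_locales
       (simp_all add: qxy_to_series_def hom_distribs fps_of_poly_add fps_of_poly_mult)
qed

lemma qxy_to_series_varX: "qxy_to_series varX = fps_const fps_X"
  by (simp add: qxy_to_series_def varX_def map_poly_pCons fps_of_poly_pCons)

lemma qxy_to_series_varY: "qxy_to_series varY = fps_X"
  by (simp add: qxy_to_series_def varY_def map_poly_pCons fps_of_poly_pCons)

lemma subst_square_varX: "subst_square (fps_const fps_X) = fps_const fls_X"
  by (rule fps_ext) (auto simp: subst_square_def elim: evenE)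

lemma subst_square_varY: "subst_square fps_X = fps_X ^ 2"
  by (rule fps_ext) (auto simp: subst_square_def fps_X_power_nth elim: evenE)

section \<open>Binomial series with Pochhammer coefficients\<close>

text \<open>The binomial series of $(1 - Xv)^{-c}$; note the sign of the exponent.\<close>

definition one_minus_pow :: "rat fps \<Rightarrow> rat \<Rightarrow> rat fps fps" where
  "one_minus_pow v c = Abs_fps (\<lambda>m. fps_const (pochhammer c m / fact m) * v ^ m)"

text \<open>Vandermonde's convolution for the upper parameters -c and -d, with the signs of upper
  negation absorbed into the Pochhammer symbols.\<close>

lemma pochhammer_binomial_convolution:
  "(\<Sum>i=0..n. (pochhammer c i / fact i) * (pochhammer d (n - i) / fact (n - i)))
     = pochhammer (c + d) n / (fact n :: 'a :: field_char_0)"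
proof -
  have p: "pochhammer c m / fact m = (-1) ^ m * ((- c) gchoose m)" for c :: 'a and m
    by (simp add: gbinomial_pochhammer)
  have "(\<Sum>i=0..n. (pochhammer c i / fact i) * (pochhammer d (n - i) / fact (n - i)))
     = (\<Sum>i=0..n. (-1) ^ n * (((- c) gchoose i) * ((- d) gchoose (n - i))))"
    by (rule sum.cong) (auto simp: p mult_ac power_add[symmetric])
  also have "\<dots> = (-1) ^ n * (fps_binomial (- c) * fps_binomial (- d)) $ n"
    by (simp add: fps_mult_nth sum_distrib_left)
  also have "\<dots> = (-1) ^ n * ((- (c + d)) gchoose n)"
    by (simp add: fps_binomial_add_mult[symmetric])
  finally show ?thesis by (simp only: p)
qed

lemma fps_const_sum: "fps_const (\<Sum>i\<in>A. f i) = (\<Sum>i\<in>A. fps_const (f i :: 'a :: comm_monoid_add))"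
  by (induction A rule: infinite_finite_induct) (auto simp flip: fps_const_add)

lemma one_minus_pow_add: "one_minus_pow v (c + d) = one_minus_pow v c * one_minus_pow v d"
proof (rule fps_ext)
  fix n
  have *: "(fps_const p * v ^ i) * (fps_const q * v ^ (n - i)) = fps_const (p * q) * v ^ n" if "i \<le> n" for p q i
  proof -
    have "v ^ n = v ^ i * v ^ (n - i)"
      using that by (simp flip: power_add)
    then show ?thesis
      by (simp only: fps_const_mult[symmetric] mult_ac)
  qed
  have "(one_minus_pow v c * one_minus_pow v d) $ n =
     (\<Sum>i=0..n. fps_const ((pochhammer c i / fact i) * (pochhammer d (n - i) / fact (n - i))) * v ^ n)"
    unfolding fps_mult_nth one_minus_pow_def
    by (rule sum.cong) (simp_all only: fps_nth_Abs_fps * atLeastAtMost_iff)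
  also have "\<dots> = fps_const (\<Sum>i=0..n. (pochhammer c i / fact i) * (pochhammer d (n - i) / fact (n - i))) * v ^ n"
    by (simp only: fps_const_sum sum_distrib_right)
  also have "\<dots> = one_minus_pow v (c + d) $ n"
    by (simp only: pochhammer_binomial_convolution one_minus_pow_def fps_nth_Abs_fps)
  finally show "one_minus_pow v (c + d) $ n = (one_minus_pow v c * one_minus_pow v d) $ n" ..
qed

lemma one_minus_pow_0: "one_minus_pow v 0 = 1"
  by (rule fps_ext) (simp add: one_minus_pow_def pochhammer_0_left)

lemma one_minus_pow_power: "one_minus_pow v c ^ n = one_minus_pow v (of_nat n * c)"
  by (induction n) (simp_all add: one_minus_pow_0 one_minus_pow_add algebra_simps)

lemma one_minus_pow_minus_1: "one_minus_pow v (- 1) = 1 - fps_X * fps_const v"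
proof (rule fps_ext)
  fix m
  consider "m = 0" | "m = 1" | k where "m = Suc (Suc k)"
    by (metis One_nat_def not0_implies_Suc)
  moreover have "fps_const (- 1) * v = - v"
    by (simp flip: fps_const_neg)
  ultimately show "one_minus_pow v (- 1) $ m = (1 - fps_X * fps_const v) $ m"
    by cases (simp_all add: one_minus_pow_def pochhammer_rec[of _ "Suc _"] pochhammer_rec)
qed

lemma fps_inverse_one_minus_X_power_nth:
  "(inverse (1 - fps_X) ^ j) $ n = pochhammer (of_nat j) n / (fact n :: 'a :: field_char_0)"
proof -
  have "inverse (1 - fps_X :: 'a fps) ^ j = fps_binomial (- of_nat j) oo (- fps_X)"
    unfolding fps_binomial_minus_of_nat
    by (simp add: fps_inverse_power fps_inverse_compose fps_compose_power[symmetric] fps_compose_add_distrib)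
  then show ?thesis
    by (simp add: fps_compose_uminus' gbinomial_pochhammer)
qed

section \<open>The hypergeometric coefficients\<close>

text \<open>The duplication formula splits (2m)_{2s} / (2s)! into (m)_s (m + 1/2)_s / ((1/2)_s
  (1)_s). The three symbols of index r + s split at r or s to supply exactly these factors.\<close>

lemma pochhammer_ratio_identity:
  fixes r s :: nat
  defines "m \<equiv> Suc r" and "k \<equiv> 2 * of_nat s + (1 :: rat)"
  defines "p0 \<equiv> pochhammer (of_nat (2 * m)) (2 * s) / (fact (2 * s) :: rat)"
  shows "psi_coeff r s = pochhammer (k / 2) r / fact r * p0 / (of_nat m * k)"
proof -
  have k0: "k > 0" by (simp add: k_def add_nonneg_pos)
  have k2: "k / 2 = 1/2 + of_nat s" by (simp add: k_def)
  have "p0 = pochhammer (2 * of_nat m) (2 * s) / pochhammer (2 * (1/2)) (2 * s)"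
    by (simp add: p0_def pochhammer_fact)
  also have "\<dots> = pochhammer (of_nat m) s * pochhammer (of_nat m + 1/2) s / (pochhammer (1/2) s * pochhammer 1 s)"
    unfolding pochhammer_double by simp
  finally have p0: "p0 = pochhammer (of_nat m) s * pochhammer (of_nat m + 1/2) s / (pochhammer (1/2) s * pochhammer 1 s)" .
  have 1: "pochhammer (1/2) (r + s) = pochhammer (1/2) s * pochhammer (k / 2) r"
    by (simp add: k2 pochhammer_product' add.commute[of r s])
  have 2: "pochhammer 1 (r + s) = pochhammer 1 r * pochhammer (of_nat m :: rat) s"
    by (simp add: pochhammer_product' m_def)
  have 3: "pochhammer (3/2) (r + s) = pochhammer (3/2) r * pochhammer (of_nat m + 1/2 :: rat) s"
    by (simp add: pochhammer_product' m_def add_ac)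
  have 4: "pochhammer 2 r = of_nat m * (fact r :: rat)"
    using pochhammer_rec[of "1 :: rat" r] by (simp add: m_def pochhammer_fact[symmetric])
  have 5: "pochhammer (3/2) s = pochhammer (1/2) s * k"
  proof -
    have "1/2 * pochhammer (3/2) s = pochhammer (1/2) s * (1/2 + of_nat s :: rat)"
      using pochhammer_rec[of "1/2 :: rat" s] pochhammer_Suc[of "1/2 :: rat" s] by simp
    then have "2 * (1/2 * pochhammer (3/2) s) = 2 * (pochhammer (1/2) s * (1/2 + of_nat s :: rat))"
      by (rule arg_cong)
    then show ?thesis by (simp add: k_def ring_distribs)
  qed
  have nz: "pochhammer (1/2) s \<noteq> (0 :: rat)" "pochhammer (3/2) r \<noteq> (0 :: rat)"
     "pochhammer 1 r \<noteq> (0 :: rat)" "pochhammer 1 s \<noteq> (0 :: rat)"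
    using pochhammer_pos[of "1/2 :: rat" s] pochhammer_pos[of "3/2 :: rat" r]
      pochhammer_pos[of "1 :: rat" r] pochhammer_pos[of "1 :: rat" s]
    by (simp_all del: pochhammer_1)
  \<comment> \<open>The cancellation is done with variables, so that simplification cannot rewrite
    the Pochhammer symbols.\<close>
  have cancel: "(hs * cr) * (r1 * ms) * (r3 * mh) / (r1 * r3 * (M * fr) * hs * s1 * (hs * k))
      = cr / fr * (ms * mh / (hs * s1)) / (M * k)"
    if "hs \<noteq> 0" "r1 \<noteq> 0" "r3 \<noteq> 0" for hs cr r1 ms r3 mh M fr s1 :: rat
    using that by simp
  show ?thesis
    unfolding psi_coeff_def 1 2 3 4 5 p0 by (rule cancel[OF nz(1,3,2)])
qed

text \<open>The left side collects the contributions to the coefficient of X^m b^(2s) in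
  \<open>branch_integrand\<close>: \<open>p0\<close> and \<open>p1\<close> are coefficients of
  a^(-2m) in degrees 2s and 2s - 1 (zero when s = 0), and \<open>p2\<close> is the one of a^(-2m-1)
  in degree 2s. All are rational multiples of \<open>p0\<close>, so the sum collapses to a single
  term.\<close>

lemma psi_coeff_sum_identity:
  fixes r s :: nat
  defines "m \<equiv> Suc r" and "k \<equiv> 2 * of_nat s + (1 :: rat)"
  assumes p0: "p0 = pochhammer (of_nat (2 * m)) (2 * s) / (fact (2 * s) :: rat)"
    and p1: "p1 = (if s = 0 then 0 else pochhammer (of_nat (2 * m)) (2 * s - 1) / fact (2 * s - 1))"
    and p2: "p2 = pochhammer (of_nat (2 * m + 1)) (2 * s) / fact (2 * s)"
  shows "- 4 * (pochhammer (k / 2) m / fact m) * p0 + 2 * (pochhammer (k / 2) m / fact m) * p1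
     + 2 * (pochhammer (k / 2) r / fact r) * (p0 + p2) = k * (2 * psi_coeff r s)"
proof -
  define n :: rat where "n = of_nat r + of_nat s"
  define M :: rat where "M = of_nat m"
  have M0: "M \<noteq> 0" unfolding M_def m_def by (rule of_nat_neq_0)
  have k0: "k > 0" by (simp add: k_def add_nonneg_pos)
  have n0: "2 * n + 1 > 0" by (simp add: n_def add_nonneg_pos)
  define B where "B = pochhammer (k / 2) r / fact r"
  have A: "pochhammer (k / 2) m / fact m = B * (n + 1/2) / M"
  proof -
    have "k / 2 + of_nat r = n + 1/2" by (simp add: k_def n_def)
    then have "pochhammer (k / 2) m = pochhammer (k / 2) r * (n + 1/2)"
      by (simp only: m_def pochhammer_Suc)
    moreover have "(fact m :: rat) = M * fact r"
      by (simp only: m_def M_def fact_Suc)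
    ultimately show ?thesis by (simp add: B_def)
  qed
  have P1: "p1 = p0 * (2 * of_nat s) / (2 * n + 1)"
  proof (cases s)
    case (Suc q)
    then obtain u where u: "2 * s = Suc u" by simp
    have "p0 = pochhammer (of_nat (2 * m)) u * (of_nat (2 * m) + of_nat u) / (of_nat (2 * s) * fact u)"
      unfolding p0 u by (simp only: pochhammer_Suc fact_Suc)
    moreover have "of_nat (2 * m) + of_nat u = 2 * n + 1"
    proof -
      have "2 * of_nat s = 1 + (of_nat u :: rat)"
        using arg_cong[OF u, of "of_nat :: nat \<Rightarrow> rat"] by simp
      then show ?thesis by (simp add: m_def n_def)
    qed
    moreover have "p1 = pochhammer (of_nat (2 * m)) u / fact u"
    proof -
      have "2 * s - 1 = u" using u by simp
      then show ?thesis unfolding p1 using Suc by simp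
    qed
    ultimately have "p0 = p1 * (2 * n + 1) / of_nat (2 * s)"
      by (simp only: times_divide_eq_left divide_divide_eq_left mult.commute[of "fact u"])
    moreover have "of_nat (2 * s) \<noteq> (0 :: rat)" using Suc by simp
    ultimately have "p0 * of_nat (2 * s) = p1 * (2 * n + 1)"
      by (metis nonzero_eq_divide_eq)
    then have "p1 = p0 * of_nat (2 * s) / (2 * n + 1)"
      using n0 by (simp only: nonzero_eq_divide_eq less_imp_neq[symmetric] not_False_eq_True)
    then show ?thesis by (simp only: of_nat_mult of_nat_numeral)
  qed (simp add: p1)
  have P2: "p2 = p0 * (M + of_nat s) / M"
  proof -
    define x y where "x = pochhammer (of_nat (2 * m + 1) :: rat) (2 * s)"
      and "y = pochhammer (of_nat (2 * m) :: rat) (2 * s)"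
    have "of_nat (2 * m) * x = pochhammer (of_nat (2 * m)) (Suc (2 * s))"
      by (simp only: x_def pochhammer_rec of_nat_add of_nat_1)
    also have "\<dots> = y * (of_nat (2 * m) + of_nat (2 * s))"
      by (simp only: y_def pochhammer_Suc)
    finally have "2 * (x * M) = 2 * (y * (M + of_nat s))"
      by (simp add: M_def algebra_simps)
    then have "x = y * (M + of_nat s) / M"
      using M0 by (simp add: nonzero_eq_divide_eq)
    then show ?thesis
      unfolding p0 p2 x_def[symmetric] y_def[symmetric] by simp
  qed
  have M: "M = n + 1 - of_nat s" by (simp add: M_def m_def n_def)
  have "- 4 * (B * (n + 1/2) / M) * p0 + 2 * (B * (n + 1/2) / M) * p1 + 2 * B * (p0 + p2) =
     B * p0 / M * (- 2 * (2 * n + 1) + 2 * of_nat s + 4 * M + 2 * of_nat s)"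
  proof -
    have half: "n + 1/2 = (2 * n + 1) / 2" by simp
    have "B * (n + 1/2) / M * p1 = B * p0 / M * of_nat s"
    proof -
      have "B * (N / 2) / M * (p0 * (2 * S) / N) = B * p0 / M * S" if "N \<noteq> 0" for N S
        using that by simp
      then show ?thesis unfolding P1 half using n0 by (metis less_irrefl)
    qed
    moreover have "B * (p0 + p2) = B * p0 / M * (2 * M + of_nat s)"
      unfolding P2 using M0 by (simp add: add_divide_distrib ring_distribs)
    moreover have "B * (n + 1/2) / M * p0 = B * p0 / M * (n + 1/2)"
      by simp
    ultimately show ?thesis
      by (simp only: mult.assoc) (simp add: algebra_simps)
  qed
  \<comment> \<open>With M + s = n + 1 the bracket equals 2.\<close>
  also have "\<dots> = B * p0 / M * 2" by (simp add: M)
  also have "\<dots> = k * (2 * psi_coeff r s)"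
  proof -
    have "psi_coeff r s = B * p0 / (M * k)"
      unfolding B_def p0 M_def k_def m_def by (rule pochhammer_ratio_identity)
    then show ?thesis using k0 M0 by simp
  qed
  finally show ?thesis unfolding A B_def[symmetric] by (simp only: mult.assoc)
qed

section \<open>The series root\<close>

text \<open>Here w = 1/a, b = 1 - a and T = 2t; the conclusion is 16 Q_4(T/2) = 0. After elimination
  of Y it is a Laurent polynomial identity in a with coefficients in Z[x].\<close>

lemma quartic_param:
  fixes a w x Y T :: "'a :: comm_ring_1"
  assumes aw: "a * w = 1" and Y: "Y = (1 - a)^2 * (1 - x * w^2)"
    and T: "T = a^2 + 2 * a - 2 - x * (2 - 2 * w - w^2)"
    and I: "I = (x + Y - 1)^2 - 12 * (x * Y - x - Y)"
    and J: "J = (x + Y - 1)^2 * (x * Y - x - Y) - 6 * (x * Y - x - Y)^2 + 9 * (x + Y - 1) * (- (x * Y))"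
    and \<delta>: "\<delta> = (1 + x) * (1 + Y) * (x - Y)"
  shows "T^4 - 2 * I * T^2 + 32 * \<delta> * T + I^2 + 32 * J = 0"
proof -
  \<comment> \<open>This variant lets rewriting cancel a against w inside longer products.\<close>
  have aw': "a * (w * z) = z" for z
    using aw by (metis mult.assoc mult_1)
  have Y': "Y = 1 - 2 * a + a^2 - x * (w^2 - 2 * w + 1)"
    unfolding Y by (simp add: power2_eq_square algebra_simps aw aw')
  show ?thesis unfolding I J \<delta> T Y'
    by (simp add: eval_nat_numeral algebra_simps aw aw')
qed

abbreviation geo :: "'a :: field fps" where "geo \<equiv> inverse (1 - fps_X)"

lemma geo_mult: "(1 - fps_X) * geo = (1 :: 'a :: field fps)"
  by (simp add: inverse_mult_eq_1')

lemma swap_to_fls_X: "swap_to_fls fps_X = fps_const fls_X"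
proof (rule fps_ext)
  fix n
  have "Abs_fps (\<lambda>m. (fps_X :: rat fps fps) $ m $ n) = (if n = 0 then fps_X else 0)"
    by (rule fps_ext) (auto simp: fps_X_def)
  then show "swap_to_fls fps_X $ n = fps_const fls_X $ n"
    by (simp add: swap_to_fls_def)
qed

lemma swap_to_fls_const_X: "swap_to_fls (fps_const fps_X) = fps_X"
proof (rule fps_ext)
  fix n
  have "Abs_fps (\<lambda>m. (fps_const fps_X :: rat fps fps) $ m $ n) = (if n = 1 then 1 else 0)"
    by (rule fps_ext) (auto simp: fps_X_def)
  then show "swap_to_fls (fps_const fps_X) $ n = fps_X $ n"
    by (simp add: swap_to_fls_def fps_X_def)
qed

lemma swap_to_fls_const_geo: "swap_to_fls (fps_const geo) = geo"
proof -
  have "fps_const (1 - fps_X :: rat fps) = 1 - fps_const fps_X"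
    by (simp flip: fps_const_sub)
  then have "(1 - fps_X) * swap_to_fls (fps_const geo) = swap_to_fls (fps_const ((1 - fps_X) * geo))"
    by (simp only: fps_const_mult[symmetric] swap_to_fls.hom_mult swap_to_fls.hom_minus
        swap_to_fls.hom_one swap_to_fls_const_X)
  also have "\<dots> = 1" by (simp add: geo_mult)
  finally show ?thesis by (metis fps_inverse_unique)
qed

text \<open>This is (1 - X/a^2)^(-c) as a series in b: c = -1/2 gives the square root, c = 1/2 its
  inverse.\<close>

definition sqrt_pow :: "rat \<Rightarrow> rat fls fps" where
  "sqrt_pow c = swap_to_fls (one_minus_pow (geo ^ 2) c)"

lemma sqrt_pow_inverse: "sqrt_pow (- (1/2)) * sqrt_pow (1/2) = 1"
  by (simp add: sqrt_pow_def one_minus_pow_0 flip: swap_to_fls.hom_mult one_minus_pow_add)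

lemma sqrt_pow_square: "sqrt_pow (- (1/2)) ^ 2 = 1 - fps_const fls_X * geo ^ 2"
proof -
  have "sqrt_pow (- (1/2)) ^ 2 = swap_to_fls (1 - fps_X * fps_const geo ^ 2)"
    by (simp add: sqrt_pow_def one_minus_pow_minus_1 one_minus_pow_power flip: swap_to_fls.hom_power)
  then show ?thesis
    by (simp only: swap_to_fls.hom_mult swap_to_fls.hom_minus swap_to_fls.hom_power
        swap_to_fls.hom_one swap_to_fls_X swap_to_fls_const_geo)
qed

text \<open>The root $2t$ of the rational parametrization, as a series in $b$ with $1/a = 1/(1 - b)$.\<close>

definition branch :: "rat fls fps" where
  "branch = 1 - 4 * fps_X + fps_X ^ 2 - fps_const fls_X * (2 - 2 * geo - geo ^ 2)"

text \<open>The integrand of Lagrange inversion, (2t)' (1 - X/a^2)^(-c), kept as a series in X over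
  Q[[b]]: in this order the coefficient of each X^m is an explicit combination of powers of 1/(1 -
  b).\<close>

definition branch_integrand :: "rat \<Rightarrow> rat fps fps" where
  "branch_integrand c = (fps_const (fps_const (- 4) + fps_const 2 * fps_X)
      + fps_X * fps_const (fps_const 2 * (geo ^ 2 + geo ^ 3))) * one_minus_pow (geo ^ 2) c"

lemma deriv_branch_times_sqrt_pow:
  "fps_deriv branch * sqrt_pow c = swap_to_fls (branch_integrand c)"
proof -
  have dgeo: "fps_deriv geo = (geo ^ 2 :: rat fls fps)"
    by (subst fps_inverse_deriv) (simp_all add: power2_eq_square)
  have num: "fps_deriv (numeral k :: rat fls fps) = 0" for k
    by (metis fps_deriv_const numeral_fps_const)
  have "fps_deriv branch = - 4 + 2 * fps_X + fps_const fls_X * (2 * (geo ^ 2 + geo ^ 3))"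
    by (simp add: branch_def num dgeo fps_deriv_power power2_eq_square power3_eq_cube algebra_simps)
  also have "\<dots> = swap_to_fls (fps_const (fps_const (- 4) + fps_const 2 * fps_X)
      + fps_X * fps_const (fps_const 2 * (geo ^ 2 + geo ^ 3)))"
  proof -
    have c: "fps_const (fps_const (numeral k)) = (numeral k :: rat fps fps)" for k
      by (simp only: numeral_fps_const)
    have "fps_const (fps_const (- 4) + fps_const 2 * fps_X) = - 4 + 2 * fps_const (fps_X :: rat fps)"
      by (simp flip: fps_const_add fps_const_mult fps_const_neg add: c)
    moreover have "fps_const (fps_const 2 * (geo ^ 2 + geo ^ 3 :: rat fps)) = 2 * (fps_const geo ^ 2 + fps_const geo ^ 3)"
      by (simp flip: fps_const_add fps_const_mult add: c)
    ultimately show ?thesis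
      by (simp only: swap_to_fls.hom_mult swap_to_fls.hom_minus swap_to_fls.hom_power swap_to_fls.hom_add
        swap_to_fls.hom_uminus swap_to_fls.hom_one swap_to_fls.hom_numeral swap_to_fls_X swap_to_fls_const_X swap_to_fls_const_geo)
  qed
  finally show ?thesis
    by (simp add: branch_integrand_def sqrt_pow_def swap_to_fls.hom_mult)
qed

lemma serW_nth_0: "serW $ s $ 0 = (if s = 0 then 1 else 0)"
  and serW_nth_Suc: "serW $ s $ Suc r = - (1/2) * psi_coeff r s"
proof -
  have "qxy_to_series ([:[:1/2:]:] * varX) = fps_const (fps_const (1/2) * fps_X)"
    by (simp add: qxy_to_series_def varX_def map_poly_pCons fps_of_poly_pCons)
  then have s: "serW = 1 - fps_const (fps_const (1/2) * fps_X) * Psi"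
    by (simp add: serW_def)
  show "serW $ s $ 0 = (if s = 0 then 1 else 0)"
    by (simp add: s)
  show "serW $ s $ Suc r = - (1/2) * psi_coeff r s"
    by (simp add: s Psi_def mult.assoc)
qed

lemma branch_integrand_nth:
  "branch_integrand (of_nat (2 * s + 1) / 2) $ m $ (2 * s) = of_nat (2 * s + 1) * (- 4 * serW $ s $ m)"
proof (cases m)
  case 0
  \<comment> \<open>Without X the integrand is -4 + 2b; the term 2b has odd degree and never meets
    b^(2s).\<close>
  show ?thesis
    by (cases "s = 0") (simp_all add: 0 branch_integrand_def one_minus_pow_def serW_nth_0)
next
  case (Suc r)
  define c where "c = (2 * of_nat s + 1 :: rat)"
  have c: "of_nat (2 * s + 1) = c" by (simp add: c_def)
  have [simp]: "of_nat (2 * s + 1) / 2 = c / 2" by (simp add: c_def)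
  define A where "A = pochhammer (c / 2) (Suc r) / fact (Suc r)"
  define B where "B = pochhammer (c / 2) r / fact r"
  have pw: "(geo ^ 2) ^ m' = (geo ^ (2 * m') :: rat fps)" for m'
    by (simp add: power_mult)
  have "branch_integrand (c / 2) $ Suc r =
      (fps_const (- 4) + fps_const 2 * fps_X) * (fps_const A * geo ^ (2 * Suc r))
      + (fps_const 2 * (geo ^ 2 + geo ^ 3)) * (fps_const B * geo ^ (2 * r))"
  proof -
    have split: "((fps_const U + fps_X * fps_const V) * P) $ Suc r = U * P $ Suc r + V * P $ r"
      for U V :: "rat fps" and P
      by (simp only: distrib_right mult.assoc fps_add_nth fps_mult_left_const_nth fps_X_mult_nth) simp
    show ?thesis
      unfolding branch_integrand_def split one_minus_pow_def A_def B_def fps_nth_Abs_fps pw ..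
  qed
  also have "\<dots> = fps_const (- 4 * A) * geo ^ (2 * Suc r) + fps_const (2 * A) * (fps_X * geo ^ (2 * Suc r))
      + fps_const (2 * B) * (geo ^ (2 * Suc r) + geo ^ (2 * Suc r + 1))"
  proof -
    have g: "geo ^ (2 * Suc r) = (geo ^ 2 * geo ^ (2 * r) :: rat fps)"
      "geo ^ (2 * Suc r + 1) = (geo ^ 3 * geo ^ (2 * r) :: rat fps)"
      by (simp_all add: power2_eq_square power3_eq_cube mult_ac)
    show ?thesis
      unfolding g fps_const_mult[symmetric] by (simp only: distrib_right distrib_left mult_ac)
  qed
  finally have eq: "branch_integrand (c / 2) $ Suc r = \<dots>" .
  have "branch_integrand (c / 2) $ Suc r $ (2 * s) = - 4 * A * (geo ^ (2 * Suc r)) $ (2 * s)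
      + 2 * A * (if s = 0 then 0 else (geo ^ (2 * Suc r)) $ (2 * s - 1))
      + 2 * B * ((geo ^ (2 * Suc r)) $ (2 * s) + (geo ^ (2 * Suc r + 1)) $ (2 * s))"
    unfolding eq by (simp only: fps_add_nth fps_mult_left_const_nth fps_X_mult_nth) simp
  also have "\<dots> = c * (2 * psi_coeff r s)"
    unfolding A_def B_def c_def fps_inverse_one_minus_X_power_nth
    by (rule psi_coeff_sum_identity) (rule refl)+
  finally show ?thesis unfolding Suc c by (simp add: serW_nth_Suc)
qed

text \<open>The square root y = b (1 - X/a^2)^(1/2) of Y; its compositional inverse is beta.\<close>

definition uniformizer :: "rat fls fps" where
  "uniformizer = fps_X * sqrt_pow (- (1/2))"

lemma uniformizer_nth: "uniformizer $ 0 = 0" "uniformizer $ 1 \<noteq> 0"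
proof -
  have "(sqrt_pow (- (1/2)) * sqrt_pow (1/2)) $ 0 = 1"
    by (simp add: sqrt_pow_inverse)
  then show "uniformizer $ 0 = 0" "uniformizer $ 1 \<noteq> 0"
    by (auto simp: uniformizer_def)
qed

lemma sqrt_pow_power: "sqrt_pow c ^ n = sqrt_pow (of_nat n * c)"
  by (simp add: sqrt_pow_def one_minus_pow_power flip: swap_to_fls.hom_power)

definition root_series :: "rat fls fps" where
  "root_series = branch oo fps_inv uniformizer"

lemma fps_inv_nth_0: "fps_inv f $ 0 = 0"
  by (simp add: fps_inv_def)

text \<open>Lagrange inversion with \<phi> = (1 - X/a^2)^(-1/2) and n = 2s + 1: the integrand
  carries the exponent -n/2, its coefficient is read at b^(n-1) = b^(2s), and the factor n
  cancels.\<close>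

lemma root_series_nth:
  "root_series $ (2 * s + 1) = - 4 * fps_to_fls (serW $ s)"
proof -
  define n where "n = 2 * s + 1"
  have "root_series oo uniformizer = branch"
    unfolding root_series_def
    by (simp add: fps_compose_assoc[symmetric] uniformizer_nth(1) fps_inv[OF uniformizer_nth] fps_inv_nth_0)
  then have "of_nat n * root_series $ n = (fps_deriv branch * sqrt_pow (1/2) ^ n) $ (n - 1)"
    using fps_lagrange_inversion[OF sqrt_pow_inverse, of n root_series]
    by (simp add: uniformizer_def n_def)
  also have "\<dots> = swap_to_fls (branch_integrand (of_nat n / 2)) $ (2 * s)"
  proof -
    have "n - 1 = 2 * s" "of_nat n * (1/2) = (of_nat n / 2 :: rat)"
      by (simp_all add: n_def)
    then show ?thesis
      by (simp only: sqrt_pow_power deriv_branch_times_sqrt_pow)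
  qed
  also have "\<dots> = fps_to_fls (fps_const (of_nat n) * (fps_const (- 4) * serW $ s))"
    unfolding swap_to_fls_def n_def fps_nth_Abs_fps branch_integrand_nth
    by (rule arg_cong[of _ _ fps_to_fls]) (rule fps_ext, simp)
  also have "\<dots> = of_nat n * (- 4 * fps_to_fls (serW $ s))"
    by (simp only: fls_times_fps_to_fls fps_const_to_fls fls_of_nat fls_const_uminus fls_const_numeral)
  finally show ?thesis
    unfolding n_def by (metis mult_left_cancel of_nat_eq_0_iff add_is_0 one_neq_zero)
qed

text \<open>Only the square of \<open>uniformizer oo \<gamma>\<close> enters, so beta(y) and
  beta(-y) both produce roots over the same Y = y^2.\<close>

lemma root_relation:
  fixes \<gamma> :: "rat fls fps"
  assumes \<gamma>: "\<gamma> $ 0 = 0" and Y: "(uniformizer oo \<gamma>) ^ 2 = Y"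
    and I: "I = (fps_const fls_X + Y - 1)^2 - 12 * (fps_const fls_X * Y - fps_const fls_X - Y)"
    and J: "J = (fps_const fls_X + Y - 1)^2 * (fps_const fls_X * Y - fps_const fls_X - Y)
      - 6 * (fps_const fls_X * Y - fps_const fls_X - Y)^2
      + 9 * (fps_const fls_X + Y - 1) * (- (fps_const fls_X * Y))"
    and \<delta>: "\<delta> = (1 + fps_const fls_X) * (1 + Y) * (fps_const fls_X - Y)"
    and t: "t = fps_const (1/2) * (branch oo \<gamma>)"
  shows "16 * t^4 - 8 * I * t^2 + 64 * \<delta> * t + I^2 + 32 * J = 0"
proof -
  define a where "a = 1 - \<gamma>"
  define w where "w = geo oo \<gamma>"
  define T where "T = branch oo \<gamma>"
  have num: "(numeral k :: rat fls fps) oo \<gamma> = numeral k" for k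
    by (metis fps_const_compose numeral_fps_const)
  note comp = fps_compose_add_distrib fps_compose_sub_distrib fps_compose_mult_distrib[OF \<gamma>]
    fps_compose_power[OF \<gamma>, symmetric] num \<gamma>
  have "a * w = ((1 - fps_X) * geo) oo \<gamma>"
    by (simp add: comp a_def w_def)
  then have aw: "a * w = 1" by (simp add: geo_mult)
  have "Y = (uniformizer ^ 2) oo \<gamma>"
    by (simp add: comp Y)
  also have "uniformizer ^ 2 = fps_X ^ 2 * (1 - fps_const fls_X * geo ^ 2)"
    by (simp add: uniformizer_def power_mult_distrib sqrt_pow_square)
  also have "\<dots> oo \<gamma> = (1 - a)^2 * (1 - fps_const fls_X * w^2)"
    by (simp add: comp a_def w_def)
  finally have Y': "Y = (1 - a)^2 * (1 - fps_const fls_X * w^2)" .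
  have "T = 1 - 4 * \<gamma> + \<gamma>^2 - fps_const fls_X * (2 - 2 * w - w^2)"
    by (simp add: T_def branch_def comp w_def)
  then have "T = a^2 + 2 * a - 2 - fps_const fls_X * (2 - 2 * w - w^2)"
    by (simp add: a_def power2_eq_square algebra_simps)
  from quartic_param[OF aw Y' this I J \<delta>]
  have "T^4 - 2 * I * T^2 + 32 * \<delta> * T + I^2 + 32 * J = 0" .
  moreover have "T = 2 * t"
  proof -
    have "2 * fps_const (1/2 :: rat fls) = 1"
      by (simp only: numeral_fps_const fps_const_mult) simp
    then show ?thesis by (simp add: t T_def[symmetric] mult.assoc[symmetric])
  qed
  ultimately show ?thesis by (simp add: power_mult_distrib mult_ac)
qed

text \<open>Subtracting the value at -y kills the even coefficients and doubles the odd ones; the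
  factor 1/2, which turns 2t into t, undoes the doubling.\<close>

lemma root_difference:
  "fps_const (1/2) * root_series - fps_const (1/2) * (root_series oo (- fps_X))
     = - 4 * fps_X * subst_square serW"
proof (rule fps_ext)
  fix n
  have c: "(- 4 * fps_X * subst_square serW) $ n = - 4 * (if n = 0 then 0 else subst_square serW $ (n - 1))"
  proof -
    have "- 4 * fps_X * subst_square serW = fps_const (- 4) * (fps_X * subst_square serW)"
      by (simp flip: fps_const_neg numeral_fps_const)
    then show ?thesis by (simp only: fps_mult_left_const_nth fps_X_mult_nth)
  qed
  show "(fps_const (1/2) * root_series - fps_const (1/2) * (root_series oo (- fps_X))) $ n
     = (- 4 * fps_X * subst_square serW) $ n"
  proof (cases "even n")
    case True
    then show ?thesis unfolding c by (auto simp: fps_compose_uminus' subst_square_def)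
  next
    case False
    then obtain s where n: "n = 2 * s + 1" by (elim oddE)
    have "(fps_const (1/2) * root_series - fps_const (1/2) * (root_series oo (- fps_X))) $ n = root_series $ n"
      using False by (simp add: fps_compose_uminus')
    then show ?thesis unfolding c by (simp add: n root_series_nth[simplified] subst_square_def)
  qed
qed

lemma poly_calR_Lambda0: "poly (map_poly qxy_to_series calR) Lambda0 = 0"
proof -
  define \<beta> where "\<beta> = fps_inv uniformizer"
  define \<beta>' where "\<beta>' = \<beta> oo (- fps_X)"
  define h where "h = (\<lambda>p. subst_square (qxy_to_series p))"
  define t t' where "t = fps_const (1/2) * (branch oo \<beta>)" and "t' = fps_const (1/2) * (branch oo \<beta>')"
  have \<beta>0: "\<beta> $ 0 = 0" "\<beta>' $ 0 = 0"
    by (simp_all add: \<beta>_def \<beta>'_def fps_inv_nth_0)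
  have u: "uniformizer oo \<beta> = fps_X"
    unfolding \<beta>_def by (rule fps_inv_right[OF uniformizer_nth])
  then have "uniformizer oo \<beta>' = - fps_X"
    unfolding \<beta>'_def by (subst fps_compose_assoc) (simp_all add: \<beta>0)
  with u have sq: "(uniformizer oo \<beta>)^2 = fps_X^2" "(uniformizer oo \<beta>')^2 = fps_X^2"
    by simp_all
  have hX: "subst_square (qxy_to_series varX) = fps_const fls_X"
    by (simp add: qxy_to_series_varX subst_square_varX)
  have hY: "subst_square (qxy_to_series varY) = fps_X^2"
    by (simp add: qxy_to_series_varY subst_square_varY)
  note hom = h_def hX hY qxy_to_series.hom_mult subst_square.hom_mult qxy_to_series.hom_add subst_square.hom_add
    qxy_to_series.hom_minus subst_square.hom_minus qxy_to_series.hom_uminus subst_square.hom_uminus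
    qxy_to_series.hom_power subst_square.hom_power qxy_to_series.hom_one subst_square.hom_one
    qxy_to_series.hom_numeral subst_square.hom_numeral
  have I: "h invI = (fps_const fls_X + fps_X^2 - 1)^2 - 12 * (fps_const fls_X * fps_X^2 - fps_const fls_X - fps_X^2)"
    by (simp only: hom invI_def sigma1_def sigma2_def)
  have J: "h invJ = (fps_const fls_X + fps_X^2 - 1)^2 * (fps_const fls_X * fps_X^2 - fps_const fls_X - fps_X^2)
      - 6 * (fps_const fls_X * fps_X^2 - fps_const fls_X - fps_X^2)^2
      + 9 * (fps_const fls_X + fps_X^2 - 1) * (- (fps_const fls_X * fps_X^2))"
    by (simp only: hom invJ_def sigma1_def sigma2_def sigma3_def)
  have \<delta>: "h delta = (1 + fps_const fls_X) * (1 + fps_X^2) * (fps_const fls_X - fps_X^2)"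
    by (simp only: hom delta_def)
  note r = root_relation[OF \<beta>0(1) sq(1) I J \<delta> t_def] root_relation[OF \<beta>0(2) sq(2) I J \<delta> t'_def]
  have "branch oo \<beta>' = root_series oo (- fps_X)"
    unfolding \<beta>'_def root_series_def \<beta>_def
    by (subst fps_compose_assoc) (simp_all add: fps_inv_nth_0)
  then have diff: "t - t' = - 4 * fps_X * subst_square serW"
    using root_difference by (simp add: t_def t'_def root_series_def \<beta>_def)
  \<comment> \<open>W has constant term 1, so the difference -4 y W(X, y^2) is nonzero and the two
    roots are distinct, as the cancellation in \<open>common_root_relations\<close>
    requires.\<close>
  have "serW \<noteq> 0"
    using serW_nth_0[of 0] by auto
  then have "t \<noteq> t'"
    using diff by auto
  note rel = common_root_relations[OF r this]
  have L: "subst_square Lambda0 = (t - t')^2"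
    unfolding diff Lambda0_def
    by (simp add: subst_square.hom_mult subst_square.hom_power
        subst_square.hom_numeral hY power_mult_distrib)
  have "subst_square (poly (map_poly qxy_to_series calR) Lambda0)
      = res_sextic (h invI) (h invJ) (h calD) ((t - t')^2)"
    by (simp add: calR_eq_res_sextic qxy_to_series.poly_map_res_sextic subst_square.hom_res_sextic h_def L)
  also have "h calD = h delta ^ 2"
    by (simp only: hom calD_def)
  also have "res_sextic (h invI) (h invJ) (h delta ^ 2) ((t - t')^2) = 0"
    using rel by (rule res_sextic_common_root)
  finally show ?thesis by simp
qed

theorem mainTheorem5:
  shows
    "poly (map_poly qxy_to_series calR) Lambda0 = 0 \<and>
     (\<forall>t :: nat \<Rightarrow> qxy_closure.
        proots (map_poly qxy_to_closure quarticQ) = image_mset t (mset_set {1..4}) \<longrightarrow>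
        proots (map_poly qxy_to_closure calR) =
          image_mset (\<lambda>(i, j). (t i - t j) ^ 2)
            (mset_set {(i, j). 1 \<le> i \<and> i < j \<and> j \<le> 4})) \<and>
     calR =
       (let L = [:0, 1:]; I = [:invI:]; J = [:invJ:]; D = [:calD:]
        in L ^ 6 - 4 * I * L ^ 5 + 2 * (3 * I ^ 2 + 8 * J) * L ^ 4
           - 4 * (I ^ 3 + 4 * I * J - 104 * D) * L ^ 3
           + (I ^ 4 - 16 * I ^ 2 * J - 448 * J ^ 2 - 384 * I * D) * L ^ 2
           + 16 * (I ^ 3 * J + 24 * I * J ^ 2 + 18 * I ^ 2 * D + 432 * J * D) * L
           + [:discriminant cubicC:]) \<and>
     (\<forall>t :: nat \<Rightarrow> qxy_closure.
        proots (map_poly qxy_to_closure quarticQ) = image_mset t (mset_set {1..4}) \<longrightarrow>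
        (\<forall>i j. 1 \<le> i \<and> i < j \<and> j \<le> 4 \<longrightarrow>
           (let Z = t i + t j; \<Lambda> = (t i - t j) ^ 2
            in Z \<noteq> 0 \<and>
               \<Lambda> = qxy_to_closure invI - Z ^ 2 - 8 * qxy_to_closure delta / Z)))"
  using poly_calR_Lambda0 proots_calR calR_explicit quarticQ_edge
  unfolding Let_def by blast

end
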